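(* Let $n\geq 1$ be an integer. The number of binary bits required to represent $\binom{2^n}{2^{n-1}}$ is $2^n-\lfloor n/2\rfloor$.
   Context: The number of binary bits required to represent a positive integer $m$ is the number of digits in its base-2 expansion, i.e., $\lfloor \log_2 m\rfloor+1$. *)

theory Defs
  imports Complex_Main "HOL-Library.Log_Nat"
begin

end

theory Submission
  imports Defs
begin

text \<open>
  With \<open>C m = (2 m choose m)\<close>, the recurrence \<open>(m + 1) C (m + 1) = 2 (2 m + 1) C m\<close> shows that
  \<open>m (C m)\<^sup>2 / 16 ^ m\<close> increases and \<open>(2 m + 1) (C m)\<^sup>2 / 16 ^ m\<close> decreases, whence
  \<open>16 ^ m \<le> 4 m (C m)\<^sup>2\<close> for \<open>m \<ge> 1\<close> and \<open>(2 m + 1) (C m)\<^sup>2 \<le> 16 ^ m\<close>. For \<open>m = 2 ^ (n - 1)\<close>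
  these bounds place \<open>C m\<close> between two consecutive powers of 2.
\<close>

text \<open>Two absorption identities, passing through \<open>Suc (2 * m) choose m\<close>.\<close>

lemma central_binomial_Suc:
  "Suc m * (2 * Suc m choose Suc m) = 2 * (2 * m + 1) * (2 * m choose m)"
proof -
  have "Suc m * (2 * Suc m choose Suc m) = 2 * (Suc m * (Suc (2 * m) choose m))"
    using Suc_times_binomial[of m "Suc (2 * m)"] by (simp add: algebra_simps)
  also have "Suc m * (Suc (2 * m) choose m) = (2 * m + 1) * (2 * m choose m)"
    using binomial_absorb_comp[of "Suc (2 * m)" m] by (simp add: Suc_diff_le)
  finally show ?thesis by simp
qed

text \<open>The factor 4 gives equality at \<open>m = 1\<close>, where the induction starts.\<close>

lemma central_binomial_square_lower:
  assumes "m \<ge> 1"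
  shows "16 ^ m \<le> 4 * m * (2 * m choose m)\<^sup>2"
  using assms
proof (induction m rule: dec_induct)
  case base
  show ?case by (simp add: power2_eq_square)
next
  case (step m)
  let ?C = "2 * m choose m" and ?D = "2 * Suc m choose Suc m"
  have "Suc m * 16 ^ Suc m = 16 * Suc m * 16 ^ m" by (simp only: power_Suc ac_simps)
  also have "\<dots> \<le> 16 * Suc m * (4 * m * ?C\<^sup>2)"
    using step.IH by (intro mult_le_mono2)
  also have "\<dots> = 16 * (4 * m * Suc m) * ?C\<^sup>2" by (simp only: ac_simps)
  \<comment> \<open>\<open>4 * m * Suc m\<close> is one less than the square of
    \<open>2 * m + 1\<close>.\<close>
  also have "\<dots> \<le> 16 * (2 * m + 1)\<^sup>2 * ?C\<^sup>2"
    by (intro mult_le_mono1 mult_le_mono2) (simp add: power2_eq_square algebra_simps)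
  also have "\<dots> = 4 * (2 * (2 * m + 1) * ?C)\<^sup>2"
    by (simp only: power_mult_distrib) simp
  also have "\<dots> = Suc m * (4 * Suc m * ?D\<^sup>2)"
    unfolding central_binomial_Suc[symmetric] by (simp only: power2_eq_square ac_simps)
  finally show ?case by (simp only: Suc_mult_le_cancel1)
qed

lemma central_binomial_square_upper:
  "(2 * m + 1) * (2 * m choose m)\<^sup>2 \<le> 16 ^ m"
proof (induction m)
  case 0
  show ?case by simp
next
  case (Suc m)
  let ?C = "2 * m choose m" and ?D = "2 * Suc m choose Suc m"
  \<comment> \<open>The factor \<open>(Suc m)\<^sup>2\<close> lets the recurrence rewrite
    \<open>Suc m * ?D\<close>; it is cancelled at the end.\<close>
  have "(Suc m)\<^sup>2 * ((2 * Suc m + 1) * ?D\<^sup>2) = (2 * Suc m + 1) * (Suc m * ?D)\<^sup>2"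
    by (simp only: power2_eq_square ac_simps)
  also have "\<dots> = 4 * (2 * m + 1) * (2 * m + 3) * ((2 * m + 1) * ?C\<^sup>2)"
    unfolding central_binomial_Suc by (simp add: power2_eq_square algebra_simps)
  also have "\<dots> \<le> 4 * (2 * m + 1) * (2 * m + 3) * 16 ^ m"
    using Suc.IH by (intro mult_le_mono2)
  \<comment> \<open>\<open>(2 * m + 1) * (2 * m + 3)\<close> is one less than
    \<open>4 * (Suc m)\<^sup>2\<close>.\<close>
  also have "\<dots> \<le> 16 * (Suc m)\<^sup>2 * 16 ^ m"
    by (intro mult_le_mono1) (simp add: power2_eq_square algebra_simps)
  also have "\<dots> = (Suc m)\<^sup>2 * 16 ^ Suc m" by simp
  finally show ?case by (simp only: mult_le_cancel1) simp
qed

theorem theorem1: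
  fixes n :: nat
  assumes "n \<ge> 1"
  shows "bitlen (int (2 ^ n choose 2 ^ (n - 1))) = 2 ^ n - \<lfloor>real n / 2\<rfloor>"
proof -
  define m :: nat where "m = 2 ^ (n - 1)"
  define h where "h = n div 2"
  define C where "C = (2 * m choose m)"
  have m: "2 * m = 2 ^ n" "m \<ge> 1"
    using assms by (simp_all add: m_def flip: power_Suc)
  have h_less: "h < 2 ^ n"
    using div_le_dividend[of n 2] less_exp[of n] unfolding h_def by linarith
  have C_pos: "C > 0" by (simp add: C_def)
  have pow: "(16::nat) ^ m = (2 ^ 2 ^ n)\<^sup>2"
  proof -
    have "(16::nat) ^ m = (2 ^ 4) ^ m" by simp
    also have "\<dots> = 2 ^ (2 * m * 2)" by (simp only: flip: power_mult) (simp add: mult.commute)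
    finally show ?thesis by (simp only: m power_mult)
  qed
  have "(2 ^ 2 ^ n)\<^sup>2 \<le> 2 * 2 ^ n * C\<^sup>2"
    using central_binomial_square_lower[OF m(2)] by (simp add: pow C_def flip: m(1))
  also have "\<dots> = 2 ^ Suc n * C\<^sup>2" by simp
  \<comment> \<open>Rounding the exponent up to an even number, by \<open>n \<le> 2 * h + 1\<close>,
    makes the bound a square.\<close>
  also have "\<dots> \<le> 2 ^ (Suc h * 2) * C\<^sup>2"
    by (intro mult_le_mono1 power_increasing) (auto simp: h_def)
  also have "\<dots> = (2 ^ Suc h * C)\<^sup>2" by (simp only: power_mult power_mult_distrib)
  finally have lower: "2 ^ 2 ^ n \<le> 2 ^ Suc h * C" by (rule power2_le_imp_le) simp
  have "(2 ^ h * C)\<^sup>2 = 2 ^ (h * 2) * C\<^sup>2" by (simp only: power_mult power_mult_distrib)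
  also have "\<dots> \<le> 2 ^ n * C\<^sup>2"
    by (intro mult_le_mono1 power_increasing) (auto simp: h_def)
  \<comment> \<open>The extra 1 in \<open>2 * m + 1\<close> makes the upper bound strict.\<close>
  also have "\<dots> < (2 * m + 1) * C\<^sup>2" using C_pos m by simp
  also have "\<dots> \<le> (2 ^ 2 ^ n)\<^sup>2"
    using central_binomial_square_upper[of m] by (simp only: pow C_def)
  finally have upper: "2 ^ h * C < 2 ^ 2 ^ n" by (rule power2_less_imp_less) simp
  \<comment> \<open>The claimed bit length is \<open>Suc k\<close>; by \<open>h_less\<close> the
    subtraction does not truncate.\<close>
  define k where "k = 2 ^ n - Suc h"
  have exponent: "2 ^ n = Suc h + k" using h_less by (simp add: k_def)
  have "2 ^ k \<le> C" "C < 2 ^ Suc k"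
    using lower upper by (simp_all add: exponent power_add)
  then have "floorlog 2 C = Suc k"
    by (intro antisym floorlog_leI floorlog_ge_SucI) simp_all
  then have "bitlen (int C) = int k + 1"
    by (simp add: bitlen_def)
  moreover have "\<lfloor>real n / 2\<rfloor> = int h"
    using floor_divide_of_nat_eq[of n 2] by (simp add: h_def)
  moreover have "(2::int) ^ n = int h + int k + 1"
    using arg_cong[OF exponent, of int] by simp
  ultimately show ?thesis using m by (simp add: C_def m_def)
qed

end
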